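(* Let $\gamma(t)=(p(t),r(t))$, $t\in[0,1]$, be a constant speed geodesic on $\mathfrak C_{\Omega^\circ}$ with speed $s$, and let $u_0=a_0+b_0\partial_r$ be a tangent vector at $\gamma(0)$. Write $r_t=r(t)$, $v_t=\dot p(t)$, $\dot r_0=\dot r(0)$. The vector $q:=r_t^2v_t$ is independent of $t$; set $c:=\|q\|_2$. Then the unique parallel transport $u_t=a_t+b_t\partial_r$ of $u_0$ along $\gamma$ is given as follows. (1) If $q=0$ (equivalently $v_t\equiv0$), then $a_t=\frac{r_0}{r_t}a_0$ and $b_t=b_0$. (2) If $q\ne0$, let $e:=q/\|q\|_2$, decompose $a_0=a_0^\perp+\alpha_0e$ with $\alpha_0:=\langle a_0,e\rangle$ and $a_0^\perp\perp e$, and define $$\theta(t):=\arctan\left(\frac{s^2t+r_0\dot r_0}{c}\right)-\arctan\left(\frac{r_0\dot r_0}{c}\right).$$ Then $$a_t=\frac{r_0}{r_t}a_0^\perp+\frac{r_0\alpha_0\cos\theta(t)-b_0\sin\theta(t)}{r_t}\,e,\qquad b_t=r_0\alpha_0\sin\theta(t)+b_0\cos\theta(t).$$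
   Context: $\mathfrak C_{\Omega^\circ}=\Omega^\circ\times I$, where $\Omega^\circ\subset\mathbb R^d$ is open and $I\subset(0,\infty)$ is an open interval, with the cone metric $g_{(x,r)}=dr^2+r^2g_{\mathbb R^d}$: tangent vectors at $(x,r)$ are $a+b\partial_r$ with $a\in\mathbb R^d$, $b\in\mathbb R$, and $\langle a+b\partial_r,a'+b'\partial_r\rangle=r^2\langle a,a'\rangle+bb'$. Orthogonality, $\langle\cdot,\cdot\rangle$ and $\|\cdot\|_2$ on $\mathbb R^d$ are Euclidean. Parallel transport is with respect to the Levi-Civita connection of this metric; the speed is $s=\sqrt{\dot r_t^2+r_t^2\|v_t\|_2^2}$. *)

theory Defs
  imports "HOL-Analysis.Analysis"
begin

text \<open>
  A Riemannian metric on an open subset of a Euclidean space \<open>'a\<close> is a map \<open>g\<close> with \<open>g x u v\<close> the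
  inner product at \<open>x\<close> of the tangent vectors \<open>u, v :: 'a\<close>. In these global coordinates an affine
  connection is given by its Christoffel map \<open>\<Gamma>\<close>, via \<open>\<nabla>\<^sub>X Y = DY(X) + \<Gamma>(X, Y)\<close>. The
  Levi-Civita connection is the unique one that is torsion-free,
  \<open>\<nabla>\<^sub>X Y - \<nabla>\<^sub>Y X = [X, Y]\<close>, which says that \<open>\<Gamma>\<close> is symmetric, and compatible with the metric,
  \<open>X(g(Y, Z)) = g(\<nabla>\<^sub>X Y, Z) + g(Y, \<nabla>\<^sub>X Z)\<close>, which by the Leibniz rule need only be required for
  constant fields.
\<close>

definition levi_civita ::
    "('a::euclidean_space \<Rightarrow> 'a \<Rightarrow> 'a \<Rightarrow> real) \<Rightarrow> 'a \<Rightarrow> 'a \<Rightarrow> 'a \<Rightarrow> 'a" where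
  "levi_civita g x = (THE \<Gamma>. bilinear \<Gamma> \<and> (\<forall>u v. \<Gamma> u v = \<Gamma> v u) \<and>
     (\<forall>w u v. frechet_derivative (\<lambda>y. g y u v) (at x) w = g x (\<Gamma> w u) v + g x u (\<Gamma> w v)))"

text \<open>
  Curves and fields along curves are only relevant on their parameter interval \<open>T\<close>; derivatives
  are taken within \<open>T\<close>, hence one-sided at its end points.
\<close>

definition velocity :: "real set \<Rightarrow> (real \<Rightarrow> 'a::real_normed_vector) \<Rightarrow> real \<Rightarrow> 'a" where
  "velocity T f t = vector_derivative f (at t within T)"

definition covariant_derivative ::
    "('a::euclidean_space \<Rightarrow> 'a \<Rightarrow> 'a \<Rightarrow> real) \<Rightarrow> real set \<Rightarrow> (real \<Rightarrow> 'a) \<Rightarrow> (real \<Rightarrow> 'a) \<Rightarrow> real \<Rightarrow> 'a" where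
  "covariant_derivative g T \<gamma> u t = velocity T u t + levi_civita g (\<gamma> t) (velocity T \<gamma> t) (u t)"

definition parallel_along ::
    "('a::euclidean_space \<Rightarrow> 'a \<Rightarrow> 'a \<Rightarrow> real) \<Rightarrow> real set \<Rightarrow> (real \<Rightarrow> 'a) \<Rightarrow> (real \<Rightarrow> 'a) \<Rightarrow> bool" where
  "parallel_along g T \<gamma> u \<longleftrightarrow>
     (\<forall>t\<in>T. u differentiable (at t within T) \<and> covariant_derivative g T \<gamma> u t = 0)"

definition geodesic ::
    "('a::euclidean_space \<Rightarrow> 'a \<Rightarrow> 'a \<Rightarrow> real) \<Rightarrow> 'a set \<Rightarrow> real set \<Rightarrow> (real \<Rightarrow> 'a) \<Rightarrow> bool" where
  "geodesic g M T \<gamma> \<longleftrightarrow> \<gamma> ` T \<subseteq> M \<and> (\<forall>t\<in>T. \<gamma> differentiable (at t within T)) \<and>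
     parallel_along g T \<gamma> (velocity T \<gamma>)"

text \<open>A point of the cone is \<open>(x, r)\<close>, and \<open>(a, b)\<close> is the tangent vector \<open>a + b \<partial>\<^sub>r\<close>.\<close>

definition cone_metric ::
    "(real ^ 'd) \<times> real \<Rightarrow> (real ^ 'd) \<times> real \<Rightarrow> (real ^ 'd) \<times> real \<Rightarrow> real" where
  "cone_metric = (\<lambda>(x, r) (a, b) (a', b'). r\<^sup>2 * (a \<bullet> a') + b * b')"

definition cone_parallel_transport ::
    "(real \<Rightarrow> (real ^ 'd) \<times> real) \<Rightarrow> (real ^ 'd) \<times> real \<Rightarrow> (real \<Rightarrow> (real ^ 'd) \<times> real) \<Rightarrow> bool" where
  "cone_parallel_transport \<gamma> u\<^sub>0 u \<longleftrightarrow> parallel_along cone_metric {0..1} \<gamma> u \<and> u 0 = u\<^sub>0"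

end

theory Submission
  imports Defs
begin

text \<open>Along a curve \<open>(p, r)\<close> with velocity \<open>(v, r')\<close>, a field
  \<open>a + b \<partial>r\<close> with \<open>A = r a\<close> is parallel exactly when A' = - b v
  and b' = <v, A> (\<open>parallel_along_cone_iff\<close>). This system is skew, so the squared
  distance between two solutions is constant. One solution with the right initial data therefore
  gives existence and uniqueness together (\<open>cone_parallel_transport_iff\<close>), and only a
  formula has to be checked.

  A geodesic transports its own velocity, so the system also governs a = v, b = r'. It yields that
  r^2 v is constant and that (r r')' = r'^2 + r^2 |v|^2 = s^2, whence r r' = s^2 t + r(0) r'(0).

  If q = 0, then v = 0 and A, b are constant. Otherwise v = (c / r^2) e has a fixed direction: the
  part of A orthogonal to e is constant, and the pair (<A, e>, b) rotates with angular velocity c /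
  r^2. Since c^2 + (r r')^2 = r^2 s^2, this is the derivative of arctan (r r' / c), so \<theta> is
  the angle of rotation. Geometrically, e and the radial direction span a flat plane in polar
  coordinates, and \<theta> is the polar angle swept out by a straight line.\<close>

section \<open>The Levi-Civita connection of the cone metric\<close>

text \<open>Makes the definite description in \<open>levi_civita\<close> usable: compatibility and
  symmetry determine the connection at a point through the Koszul formula and nondegeneracy.\<close>

lemma levi_civita_eqI:
  fixes g :: "'a::euclidean_space \<Rightarrow> 'a \<Rightarrow> 'a \<Rightarrow> real"
  assumes sym: "\<And>u v. g x u v = g x v u"
    and nondeg: "\<And>u u'. (\<And>v. g x u v = g x u' v) \<Longrightarrow> u = u'"
    and bil: "bilinear \<Gamma>" and torsion: "\<And>u v. \<Gamma> u v = \<Gamma> v u"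
    and compat: "\<And>w u v. frechet_derivative (\<lambda>y. g y u v) (at x) w = g x (\<Gamma> w u) v + g x u (\<Gamma> w v)"
  shows "levi_civita g x = \<Gamma>"
  unfolding levi_civita_def
proof (rule the_equality)
  show "bilinear \<Gamma> \<and> (\<forall>u v. \<Gamma> u v = \<Gamma> v u) \<and>
     (\<forall>w u v. frechet_derivative (\<lambda>y. g y u v) (at x) w = g x (\<Gamma> w u) v + g x u (\<Gamma> w v))"
    using bil torsion compat by blast
next
  define D where "D = (\<lambda>w u v. frechet_derivative (\<lambda>y. g y u v) (at x) w)"
  \<comment> \<open>Koszul formula: in this signed sum of three compatibility identities, symmetry
    of \<open>G\<close> and of the metric cancels everything except twice one term.\<close>
  have koszul: "2 * g x (G u v) w = D u v w + D v u w - D w u v"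
    if "\<And>u v. G u v = G v u" "\<And>w u v. D w u v = g x (G w u) v + g x u (G w v)" for G u v w
    using that(1)[of u v] that(1)[of u w] that(1)[of v w]
      sym[of "G u w" v] sym[of "G v w" u]
    by (simp add: that(2))
  fix G
  assume G: "bilinear G \<and> (\<forall>u v. G u v = G v u) \<and>
     (\<forall>w u v. frechet_derivative (\<lambda>y. g y u v) (at x) w = g x (G w u) v + g x u (G w v))"
  have "2 * g x (G u v) w = 2 * g x (\<Gamma> u v) w" for u v w
  proof -
    have "2 * g x (G u v) w = D u v w + D v u w - D w u v"
      by (rule koszul) (use G in \<open>simp_all add: D_def\<close>)
    moreover have "2 * g x (\<Gamma> u v) w = D u v w + D v u w - D w u v"
      by (rule koszul) (simp_all add: D_def torsion compat)
    ultimately show ?thesis by simp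
  qed
  then show "G = \<Gamma>"
    by (intro ext nondeg) simp
qed

text \<open>These are the usual warped-product Christoffel symbols: 1/r for the mixed radial and
  tangential terms, and -r times the Euclidean product in the radial component.
  \<open>r \<noteq> 0\<close> makes the metric nondegenerate.\<close>

lemma levi_civita_cone:
  fixes x :: "real ^ 'd"
  assumes "r \<noteq> 0"
  shows "levi_civita cone_metric (x, r) =
    (\<lambda>(a, b) (a', b'). ((b / r) *\<^sub>R a' + (b' / r) *\<^sub>R a, - (r * (a \<bullet> a'))))"
proof (rule levi_civita_eqI)
  show "u = u'" if "\<And>v. cone_metric (x, r) u v = cone_metric (x, r) u' v"
    for u u' :: "(real ^ 'd) \<times> real"
  proof -
    have "r\<^sup>2 * (fst u \<bullet> a) = r\<^sup>2 * (fst u' \<bullet> a)" for a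
      using that[of "(a, 0)"] by (simp add: cone_metric_def split_beta)
    then have "fst u \<bullet> a = fst u' \<bullet> a" for a
      using assms by simp
    then have "fst u = fst u'"
      by (metis vector_eq_ldot inner_commute)
    moreover have "snd u = snd u'"
      using that[of "(0, 1)"] by (simp add: cone_metric_def split_beta)
    ultimately show ?thesis
      by (simp add: prod_eq_iff)
  qed
next
  fix w u v :: "(real ^ 'd) \<times> real"
  \<comment> \<open>The metric depends on the base point only through the factor r^2.\<close>
  have "((\<lambda>y. (snd y)\<^sup>2 * (fst u \<bullet> fst v) + snd u * snd v) has_derivative
      (\<lambda>w. 2 * r * snd w * (fst u \<bullet> fst v))) (at (x, r))"
    by (auto intro!: derivative_eq_intros)
  then have "frechet_derivative (\<lambda>y. cone_metric y u v) (at (x, r)) w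
      = 2 * r * snd w * (fst u \<bullet> fst v)"
    by (simp add: cone_metric_def split_beta frechet_derivative_at [symmetric])
  then show "frechet_derivative (\<lambda>y. cone_metric y u v) (at (x, r)) w =
      cone_metric (x, r)
        ((\<lambda>(a, b) (a', b'). ((b / r) *\<^sub>R a' + (b' / r) *\<^sub>R a, - (r * (a \<bullet> a')))) w u) v +
      cone_metric (x, r) u
        ((\<lambda>(a, b) (a', b'). ((b / r) *\<^sub>R a' + (b' / r) *\<^sub>R a, - (r * (a \<bullet> a')))) w v)"
    using assms
    by (simp add: cone_metric_def split_beta inner_add_left inner_add_right inner_commute
        power2_eq_square field_simps)
qed (use assms in \<open>auto simp: cone_metric_def inner_commute bilinear_def linear_iff split_beta
      algebra_simps inner_add_left inner_add_right add_divide_distrib\<close>)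

section \<open>Derivatives and parallel fields on the unit interval\<close>

lemma velocity_eqI:
  fixes f :: "real \<Rightarrow> 'a::euclidean_space"
  assumes "(f has_vector_derivative f') (at t within {0..1})" "t \<in> {0..1}"
  shows "velocity {0..1} f t = f'"
  unfolding velocity_def
  using assms by (intro vector_derivative_within_closed_interval) auto

lemma has_vector_derivative_Pair_iff:
  "((\<lambda>t. (f t, g t)) has_vector_derivative (f', g')) (at t within S) \<longleftrightarrow>
    (f has_vector_derivative f') (at t within S) \<and> (g has_vector_derivative g') (at t within S)"
proof
  assume *: "((\<lambda>t. (f t, g t)) has_vector_derivative (f', g')) (at t within S)"
  show "(f has_vector_derivative f') (at t within S) \<and> (g has_vector_derivative g') (at t within S)"
    using bounded_linear.has_vector_derivative[OF bounded_linear_fst *]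
      bounded_linear.has_vector_derivative[OF bounded_linear_snd *] by simp
qed (auto intro: has_vector_derivative_Pair)

text \<open>Merges differentiability and the vanishing covariant derivative into one derivative
  statement, to which the usual calculus rules apply.\<close>

lemma parallel_along_unit_interval_iff:
  "parallel_along g {0..1} \<gamma> u \<longleftrightarrow> (\<forall>t\<in>{0..1}. (u has_vector_derivative
     - levi_civita g (\<gamma> t) (velocity {0..1} \<gamma> t) (u t)) (at t within {0..1}))"
  unfolding parallel_along_def covariant_derivative_def
proof (intro ball_cong refl iffI)
  fix t :: real
  assume t: "t \<in> {0..1}"
  {
    assume "u differentiable (at t within {0..1}) \<and>
      velocity {0..1} u t + levi_civita g (\<gamma> t) (velocity {0..1} \<gamma> t) (u t) = 0"
    then show "(u has_vector_derivative
        - levi_civita g (\<gamma> t) (velocity {0..1} \<gamma> t) (u t)) (at t within {0..1})"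
      by (metis vector_derivative_works velocity_def add_eq_0_iff2)
  next
    assume "(u has_vector_derivative
        - levi_civita g (\<gamma> t) (velocity {0..1} \<gamma> t) (u t)) (at t within {0..1})"
    then show "u differentiable (at t within {0..1}) \<and>
      velocity {0..1} u t + levi_civita g (\<gamma> t) (velocity {0..1} \<gamma> t) (u t) = 0"
      using velocity_eqI[OF _ t, of u] by (auto intro: differentiableI_vector)
  }
qed

lemma constant_on_unit_interval:
  assumes "\<And>t. t \<in> {0..1} \<Longrightarrow> (f has_vector_derivative 0) (at t within {0..1})" "t \<in> {0..1}"
  shows "f t = f 0"
proof -
  obtain k where "\<And>t. t \<in> {0..1} \<Longrightarrow> f t = k"
    using has_vector_derivative_zero_constant[OF convex_real_interval(5) assms(1)] by blast
  then show ?thesis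
    using assms(2) by simp
qed

section \<open>Parallel transport on the cone as a skew system\<close>

text \<open>The rescaled field \<open>A = r a\<close> turns the parallel transport equation into the skew system
  \<open>A' = - b v\<close>, \<open>b' = \<langle>v, A\<rangle>\<close>.\<close>

lemma parallel_along_cone_iff:
  fixes p v :: "real \<Rightarrow> real ^ 'd"
  assumes p: "\<And>t. t \<in> {0..1} \<Longrightarrow> (p has_vector_derivative v t) (at t within {0..1})"
    and r: "\<And>t. t \<in> {0..1} \<Longrightarrow> (r has_vector_derivative r' t) (at t within {0..1})"
    and pos: "\<And>t. t \<in> {0..1} \<Longrightarrow> r t > 0"
  shows "parallel_along cone_metric {0..1} (\<lambda>t. (p t, r t)) u \<longleftrightarrow>
    (\<forall>t\<in>{0..1}.
      ((\<lambda>t. r t *\<^sub>R fst (u t)) has_vector_derivative - (snd (u t) *\<^sub>R v t)) (at t within {0..1}) \<and>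
      ((\<lambda>t. snd (u t)) has_vector_derivative v t \<bullet> (r t *\<^sub>R fst (u t))) (at t within {0..1}))"
  unfolding parallel_along_unit_interval_iff
proof (intro ball_cong refl)
  fix t :: real
  assume t: "t \<in> {0..1}"
  define F where "F = at t within {0..1::real}"
  define a b where "a = (\<lambda>t. fst (u t))" and "b = (\<lambda>t. snd (u t))"
  have rt: "r t \<noteq> 0" using pos[OF t] by simp
  have rF: "(r has_real_derivative r' t) F"
    using r[OF t] by (simp add: F_def has_real_derivative_iff_has_vector_derivative)
  have vel: "velocity {0..1} (\<lambda>t. (p t, r t)) t = (v t, r' t)"
    by (rule velocity_eqI[OF has_vector_derivative_Pair[OF p[OF t] r[OF t]] t])
  have inv: "((\<lambda>t. inverse (r t)) has_real_derivative - (r' t / (r t)\<^sup>2)) F"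
    using DERIV_inverse_fun[OF rF[unfolded F_def] rt]
    by (simp add: F_def power2_eq_square divide_inverse ac_simps)
  have "(u has_vector_derivative - levi_civita cone_metric (p t, r t)
        (velocity {0..1} (\<lambda>t. (p t, r t)) t) (u t)) F \<longleftrightarrow>
      ((\<lambda>t. (a t, b t)) has_vector_derivative
        (- ((r' t / r t) *\<^sub>R a t + (b t / r t) *\<^sub>R v t), r t * (v t \<bullet> a t))) F"
    using rt by (simp add: levi_civita_cone vel a_def b_def split_beta)
  also have "\<dots> \<longleftrightarrow>
      (a has_vector_derivative - ((r' t / r t) *\<^sub>R a t + (b t / r t) *\<^sub>R v t)) F \<and>
      (b has_vector_derivative r t * (v t \<bullet> a t)) F"
    unfolding F_def by (rule has_vector_derivative_Pair_iff)
  \<comment> \<open>In the product rule for r a, the term r' a cancels against the Christoffel term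
    (r'/r) a; the converse multiplies r a by 1/r.\<close>
  also have "(a has_vector_derivative - ((r' t / r t) *\<^sub>R a t + (b t / r t) *\<^sub>R v t)) F \<longleftrightarrow>
      ((\<lambda>t. r t *\<^sub>R a t) has_vector_derivative - (b t *\<^sub>R v t)) F"
  proof
    assume a: "(a has_vector_derivative - ((r' t / r t) *\<^sub>R a t + (b t / r t) *\<^sub>R v t)) F"
    show "((\<lambda>t. r t *\<^sub>R a t) has_vector_derivative - (b t *\<^sub>R v t)) F"
      using has_vector_derivative_scaleR[OF rF[unfolded F_def] a[unfolded F_def]] rt
      by (simp add: F_def scaleR_diff_right)
  next
    assume A: "((\<lambda>t. r t *\<^sub>R a t) has_vector_derivative - (b t *\<^sub>R v t)) F"
    have "((\<lambda>t. inverse (r t) *\<^sub>R (r t *\<^sub>R a t)) has_vector_derivative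
        - ((r' t / r t) *\<^sub>R a t + (b t / r t) *\<^sub>R v t)) F"
    proof -
      have "inverse (r t) *\<^sub>R - (b t *\<^sub>R v t) + - (r' t / (r t)\<^sup>2) *\<^sub>R (r t *\<^sub>R a t)
          = - ((r' t / r t) *\<^sub>R a t + (b t / r t) *\<^sub>R v t)"
        using rt by (simp add: power2_eq_square divide_inverse mult.commute)
      then show ?thesis
        using has_vector_derivative_scaleR[OF inv[unfolded F_def] A[unfolded F_def]]
        by (simp add: F_def del: scaleR_scaleR)
    qed
    then show "(a has_vector_derivative - ((r' t / r t) *\<^sub>R a t + (b t / r t) *\<^sub>R v t)) F"
      \<comment> \<open>Multiplying r a by 1/r returns a only where r is nonzero, which is known on
        the unit interval.\<close>
      unfolding F_def
      by (rule has_vector_derivative_transform[OF t, rotated]) (use pos in force)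
  qed
  finally show "(u has_vector_derivative - levi_civita cone_metric (p t, r t)
        (velocity {0..1} (\<lambda>t. (p t, r t)) t) (u t)) (at t within {0..1}) \<longleftrightarrow>
      ((\<lambda>t. r t *\<^sub>R fst (u t)) has_vector_derivative - (snd (u t) *\<^sub>R v t)) (at t within {0..1}) \<and>
      ((\<lambda>t. snd (u t)) has_vector_derivative v t \<bullet> (r t *\<^sub>R fst (u t))) (at t within {0..1})"
    by (simp add: F_def a_def b_def)
qed

text \<open>Reduces the transport problem to exhibiting one solution \<open>(A, b)\<close>: it is
  itself a transport after division by r, and every other transport stays at distance zero from
  it.\<close>

lemma cone_parallel_transport_iff:
  fixes p v :: "real \<Rightarrow> real ^ 'd" and A :: "real \<Rightarrow> real ^ 'd"
  assumes p: "\<And>t. t \<in> {0..1} \<Longrightarrow> (p has_vector_derivative v t) (at t within {0..1})"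
    and r: "\<And>t. t \<in> {0..1} \<Longrightarrow> (r has_vector_derivative r' t) (at t within {0..1})"
    and pos: "\<And>t. t \<in> {0..1} \<Longrightarrow> r t > 0"
    and A: "\<And>t. t \<in> {0..1} \<Longrightarrow> (A has_vector_derivative - (b t *\<^sub>R v t)) (at t within {0..1})"
    and b: "\<And>t. t \<in> {0..1} \<Longrightarrow> (b has_vector_derivative v t \<bullet> A t) (at t within {0..1})"
    and init: "A 0 = r 0 *\<^sub>R a\<^sub>0" "b 0 = b\<^sub>0"
  shows "cone_parallel_transport (\<lambda>t. (p t, r t)) (a\<^sub>0, b\<^sub>0) u \<longleftrightarrow>
    (\<forall>t\<in>{0..1}. u t = ((1 / r t) *\<^sub>R A t, b t))"
proof
  assume u: "cone_parallel_transport (\<lambda>t. (p t, r t)) (a\<^sub>0, b\<^sub>0) u"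
  define B where "B = (\<lambda>t. r t *\<^sub>R fst (u t))"
  define \<beta> where "\<beta> = (\<lambda>t. snd (u t))"
  have B: "(B has_vector_derivative - (\<beta> t *\<^sub>R v t)) (at t within {0..1})"
    and \<beta>: "(\<beta> has_vector_derivative v t \<bullet> B t) (at t within {0..1})" if "t \<in> {0..1}" for t
    using u that parallel_along_cone_iff[where u=u, OF p r pos]
    by (auto simp: cone_parallel_transport_def B_def \<beta>_def)
  define h where "h = (\<lambda>t. (B t - A t) \<bullet> (B t - A t) + (\<beta> t - b t) * (\<beta> t - b t))"
  \<comment> \<open>The system is skew, so the distance between two solutions is constant.\<close>
  have "(h has_vector_derivative 0) (at t within {0..1})" if t: "t \<in> {0..1}" for t
  proof -
    have 1: "((\<lambda>t. B t - A t) has_vector_derivative - ((\<beta> t - b t) *\<^sub>R v t)) (at t within {0..1})"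
      using has_vector_derivative_diff[OF B[OF t] A[OF t]] by (simp add: algebra_simps)
    have 2: "((\<lambda>t. \<beta> t - b t) has_vector_derivative v t \<bullet> (B t - A t)) (at t within {0..1})"
      using has_vector_derivative_diff[OF \<beta>[OF t] b[OF t]] by (simp add: inner_diff_right)
    show ?thesis
      using has_vector_derivative_add[OF
          bounded_bilinear.has_vector_derivative[OF bounded_bilinear_inner 1 1]
          bounded_bilinear.has_vector_derivative[OF bounded_bilinear_mult 2 2]]
      by (simp add: h_def inner_commute algebra_simps)
  qed
  then have const: "h t = h 0" if "t \<in> {0..1}" for t
    using that by (rule constant_on_unit_interval)
  have "u 0 = (a\<^sub>0, b\<^sub>0)"
    using u by (simp add: cone_parallel_transport_def)
  then have h: "h t = 0" if "t \<in> {0..1}" for t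
    unfolding const[OF that] by (simp add: h_def B_def \<beta>_def init)
  show "\<forall>t\<in>{0..1}. u t = ((1 / r t) *\<^sub>R A t, b t)"
  proof
    fix t :: real
    assume t: "t \<in> {0..1}"
    have "B t = A t" "\<beta> t = b t"
      using h[OF t] inner_ge_zero[of "B t - A t"] zero_le_square[of "\<beta> t - b t"]
      unfolding h_def by (auto simp: add_nonneg_eq_0_iff)
    then show "u t = ((1 / r t) *\<^sub>R A t, b t)"
      using pos[OF t] by (auto simp: prod_eq_iff B_def \<beta>_def simp flip: \<open>B t = A t\<close>)
  qed
next
  assume u: "\<forall>t\<in>{0..1}. u t = ((1 / r t) *\<^sub>R A t, b t)"
  have Au: "r t *\<^sub>R fst (u t) = A t" and bu: "snd (u t) = b t" if "t \<in> {0..1}" for t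
    using u pos[OF that] that by auto
  have "u 0 = (a\<^sub>0, b\<^sub>0)"
    using u pos[of 0] by (simp add: init)
  moreover have "parallel_along cone_metric {0..1} (\<lambda>t. (p t, r t)) u"
  proof (rule parallel_along_cone_iff[where v=v and r'=r', THEN iffD2]; (intro ballI conjI)?)
    fix t :: real
    assume t: "t \<in> {0..1}"
    show "((\<lambda>t. r t *\<^sub>R fst (u t)) has_vector_derivative - (snd (u t) *\<^sub>R v t)) (at t within {0..1})"
      \<comment> \<open>\<open>u\<close> is prescribed on the unit interval only, so derivatives are
        transferred within that set.\<close>
      by (rule has_vector_derivative_transform[OF t _ A[OF t, folded bu[OF t]]]) (rule Au)
    show "((\<lambda>t. snd (u t)) has_vector_derivative v t \<bullet> (r t *\<^sub>R fst (u t))) (at t within {0..1})"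
      by (rule has_vector_derivative_transform[OF t _ b[OF t, folded Au[OF t]]]) (rule bu)
  qed (fact p r pos)+
  ultimately show "cone_parallel_transport (\<lambda>t. (p t, r t)) (a\<^sub>0, b\<^sub>0) u"
    by (simp add: cone_parallel_transport_def)
qed

section \<open>Conserved quantities of the geodesic and the explicit transport\<close>

theorem propositionB6:
  fixes \<Omega> :: "(real ^ 'd) set" and I :: "real set"
    and p v :: "real \<Rightarrow> real ^ 'd" and r r' :: "real \<Rightarrow> real"
    and s c b\<^sub>0 :: real and q a\<^sub>0 :: "real ^ 'd"
  assumes "open \<Omega>" and "open I" and "is_interval I" and "I \<subseteq> {0<..}"
    and "geodesic cone_metric (\<Omega> \<times> I) {0..1} (\<lambda>t. (p t, r t))"
    and "\<And>t. t \<in> {0..1} \<Longrightarrow> v t = velocity {0..1} p t"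
    and "\<And>t. t \<in> {0..1} \<Longrightarrow> r' t = velocity {0..1} r t"
    and "\<And>t. t \<in> {0..1} \<Longrightarrow> s = sqrt ((r' t)\<^sup>2 + (r t)\<^sup>2 * (norm (v t))\<^sup>2)"
    and "q = (r 0)\<^sup>2 *\<^sub>R v 0" and "c = norm q"
  shows "(\<forall>t\<in>{0..1}. (r t)\<^sup>2 *\<^sub>R v t = q)
    \<and> (q = 0 \<longleftrightarrow> (\<forall>t\<in>{0..1}. v t = 0))
    \<and> (q = 0 \<longrightarrow>
        (\<forall>u. cone_parallel_transport (\<lambda>t. (p t, r t)) (a\<^sub>0, b\<^sub>0) u \<longleftrightarrow>
          (\<forall>t\<in>{0..1}. u t = ((r 0 / r t) *\<^sub>R a\<^sub>0, b\<^sub>0))))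
    \<and> (q \<noteq> 0 \<longrightarrow>
        (let e = (1 / norm q) *\<^sub>R q;
             \<alpha>\<^sub>0 = a\<^sub>0 \<bullet> e;
             a\<^sub>0_perp = a\<^sub>0 - \<alpha>\<^sub>0 *\<^sub>R e;
             \<theta> = (\<lambda>t. arctan ((s\<^sup>2 * t + r 0 * r' 0) / c) - arctan (r 0 * r' 0 / c))
         in \<forall>u. cone_parallel_transport (\<lambda>t. (p t, r t)) (a\<^sub>0, b\<^sub>0) u \<longleftrightarrow>
          (\<forall>t\<in>{0..1}. u t =
            ((r 0 / r t) *\<^sub>R a\<^sub>0_perp
               + ((r 0 * \<alpha>\<^sub>0 * cos (\<theta> t) - b\<^sub>0 * sin (\<theta> t)) / r t) *\<^sub>R e,
             r 0 * \<alpha>\<^sub>0 * sin (\<theta> t) + b\<^sub>0 * cos (\<theta> t)))))"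
proof -
  let ?I = "{0..1::real}"
  have geo: "geodesic cone_metric (\<Omega> \<times> I) ?I (\<lambda>t. (p t, r t))" by fact
  have pos: "r t > 0" if "t \<in> ?I" for t
    using geo that subsetD[OF assms(4), of "r t"]
    by (auto simp: geodesic_def image_subset_iff)
  have pr: "((\<lambda>t. (p t, r t)) has_vector_derivative velocity ?I (\<lambda>t. (p t, r t)) t) (at t within ?I)"
    if "t \<in> ?I" for t
    using geo that vector_derivative_works unfolding geodesic_def velocity_def by blast
  have deriv: "(p has_vector_derivative fst (velocity ?I (\<lambda>t. (p t, r t)) t)) (at t within ?I)"
    "(r has_vector_derivative snd (velocity ?I (\<lambda>t. (p t, r t)) t)) (at t within ?I)"
    if "t \<in> ?I" for t
    using pr[OF that] has_vector_derivative_Pair_iff[where f=p and g=r and t=t and S="?I"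
        and f'="fst (velocity ?I (\<lambda>t. (p t, r t)) t)"
        and g'="snd (velocity ?I (\<lambda>t. (p t, r t)) t)"]
    by simp_all
  have vel: "velocity ?I (\<lambda>t. (p t, r t)) t = (v t, r' t)" if "t \<in> ?I" for t
    using velocity_eqI[OF deriv(1)[OF that] that] velocity_eqI[OF deriv(2)[OF that] that]
    by (simp add: assms(6,7)[OF that] prod_eq_iff)
  have p: "(p has_vector_derivative v t) (at t within ?I)"
    and r: "(r has_vector_derivative r' t) (at t within ?I)" if "t \<in> ?I" for t
    using deriv[OF that] by (simp_all add: vel[OF that])
  have rd: "(r has_real_derivative r' t) (at t within ?I)" if "t \<in> ?I" for t
    using r[OF that] by (simp add: has_real_derivative_iff_has_vector_derivative)
  \<comment> \<open>The geodesic equation is the skew system for the velocity field, with a = v and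
    b = r'.\<close>
  have geo_eqs:
    "((\<lambda>t. r t *\<^sub>R fst (velocity ?I (\<lambda>t. (p t, r t)) t)) has_vector_derivative
      - (r' t *\<^sub>R v t)) (at t within ?I)"
    "((\<lambda>t. snd (velocity ?I (\<lambda>t. (p t, r t)) t)) has_vector_derivative
      v t \<bullet> (r t *\<^sub>R v t)) (at t within ?I)" if "t \<in> ?I" for t
    using geo that parallel_along_cone_iff[where u="velocity ?I (\<lambda>t. (p t, r t))", OF p r pos]
    by (auto simp: geodesic_def vel)
  have rv': "((\<lambda>t. r t *\<^sub>R v t) has_vector_derivative - (r' t *\<^sub>R v t)) (at t within ?I)"
    if "t \<in> ?I" for t
    by (rule has_vector_derivative_transform[OF that _ geo_eqs(1)[OF that]]) (simp add: vel)
  have r'': "(r' has_vector_derivative v t \<bullet> (r t *\<^sub>R v t)) (at t within ?I)"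
    if "t \<in> ?I" for t
    by (rule has_vector_derivative_transform[OF that _ geo_eqs(2)[OF that]]) (simp add: vel)
  \<comment> \<open>Conservation of angular momentum: r' (r v) + r (- r' v) = 0.\<close>
  have "((\<lambda>t. r t *\<^sub>R (r t *\<^sub>R v t)) has_vector_derivative 0) (at t within ?I)"
    if "t \<in> ?I" for t
    using has_vector_derivative_scaleR[OF rd[OF that] rv'[OF that]] by (simp add: mult.commute)
  then have rrv: "r t *\<^sub>R (r t *\<^sub>R v t) = r 0 *\<^sub>R (r 0 *\<^sub>R v 0)" if "t \<in> ?I" for t
    using that constant_on_unit_interval[of "\<lambda>t. r t *\<^sub>R (r t *\<^sub>R v t)"] by blast
  have q: "(r t)\<^sup>2 *\<^sub>R v t = q" if "t \<in> ?I" for t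
    using rrv[OF that] by (simp add: assms(9) power2_eq_square)
  have q0: "q = 0 \<longleftrightarrow> (\<forall>t\<in>?I. v t = 0)"
  proof
    assume "q = 0"
    then show "\<forall>t\<in>?I. v t = 0"
      using q pos by force
  qed (simp add: assms(9))
  have s2: "s\<^sup>2 = (r' t)\<^sup>2 + (r t)\<^sup>2 * (norm (v t))\<^sup>2" if "t \<in> ?I" for t
    using assms(8)[OF that] by simp
  \<comment> \<open>Since r'' = r |v|^2, the derivative of r r' is r'^2 + r^2 |v|^2, the squared
    speed; hence r r' is affine in t.\<close>
  have "((\<lambda>t. r t * r' t - s\<^sup>2 * t) has_vector_derivative 0) (at t within ?I)" if "t \<in> ?I" for t
  proof -
    have "((\<lambda>t. r t * r' t - s\<^sup>2 * t) has_real_derivative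
        (r' t * r' t + v t \<bullet> (r t *\<^sub>R v t) * r t) - s\<^sup>2) (at t within ?I)"
      using r''[OF that] rd[OF that]
      by (auto intro!: derivative_eq_intros simp: has_real_derivative_iff_has_vector_derivative[symmetric])
    moreover have "(r' t * r' t + v t \<bullet> (r t *\<^sub>R v t) * r t) - s\<^sup>2 = 0"
      by (simp add: s2[OF that] power2_norm_eq_inner) (simp add: power2_eq_square)
    ultimately show ?thesis
      by (simp add: has_real_derivative_iff_has_vector_derivative)
  qed
  then have rr'_s: "r t * r' t - s\<^sup>2 * t = r 0 * r' 0 - s\<^sup>2 * 0" if "t \<in> ?I" for t
    using that constant_on_unit_interval[of "\<lambda>t. r t * r' t - s\<^sup>2 * t"] by blast
  have rr': "s\<^sup>2 * t + r 0 * r' 0 = r t * r' t" if "t \<in> ?I" for t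
    using rr'_s[OF that] by (simp add: algebra_simps)
  have zero: "cone_parallel_transport (\<lambda>t. (p t, r t)) (a\<^sub>0, b\<^sub>0) u \<longleftrightarrow>
      (\<forall>t\<in>?I. u t = ((r 0 / r t) *\<^sub>R a\<^sub>0, b\<^sub>0))" if "q = 0" for u
  proof -
    have "v t = 0" if "t \<in> ?I" for t
      using that \<open>q = 0\<close> q0 by blast
    then show ?thesis
      by (subst cone_parallel_transport_iff[where A="\<lambda>_. r 0 *\<^sub>R a\<^sub>0" and b="\<lambda>_. b\<^sub>0", OF p r pos])
        auto
  qed
  define e where "e = (1 / norm q) *\<^sub>R q"
  define \<alpha> where "\<alpha> = a\<^sub>0 \<bullet> e"
  define n where "n = a\<^sub>0 - \<alpha> *\<^sub>R e"
  define \<theta> where "\<theta> = (\<lambda>t. arctan ((s\<^sup>2 * t + r 0 * r' 0) / c) - arctan (r 0 * r' 0 / c))"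
  have nonzero: "cone_parallel_transport (\<lambda>t. (p t, r t)) (a\<^sub>0, b\<^sub>0) u \<longleftrightarrow>
      (\<forall>t\<in>?I. u t = ((r 0 / r t) *\<^sub>R n
           + ((r 0 * \<alpha> * cos (\<theta> t) - b\<^sub>0 * sin (\<theta> t)) / r t) *\<^sub>R e,
         r 0 * \<alpha> * sin (\<theta> t) + b\<^sub>0 * cos (\<theta> t)))" if "q \<noteq> 0" for u
  proof -
    have c: "c > 0" using that assms(10) by simp
    have norm_e: "norm e = 1"
      using that by (simp add: e_def)
    then have ee: "e \<bullet> e = 1"
      by (simp add: norm_eq_1)
    have ne: "e \<bullet> n = 0"
      by (simp add: n_def \<alpha>_def inner_diff_right ee inner_commute)
    have v: "v t = (c / (r t)\<^sup>2) *\<^sub>R e" if "t \<in> ?I" for t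
    proof -
      have "v t = (1 / (r t)\<^sup>2) *\<^sub>R q"
        using pos[OF that] by (simp flip: q[OF that])
      then show ?thesis
        using c by (simp add: e_def assms(10))
    qed
    have \<theta>': "(\<theta> has_real_derivative c / (r t)\<^sup>2) (at t within ?I)" if "t \<in> ?I" for t
    proof -
      \<comment> \<open>The speed identity multiplied by r^2, with |v| = c / r^2. It turns the
        derivative of the arctangent into c / r^2, and c > 0 forces s to be nonzero.\<close>
      have sum: "c\<^sup>2 + (r t * r' t)\<^sup>2 = (r t)\<^sup>2 * s\<^sup>2"
        using pos[OF that] c
        by (simp add: s2[OF that] v[OF that] norm_e)
          (simp add: field_simps power2_eq_square)
      have "s\<^sup>2 \<noteq> 0"
        using sum c by (auto simp: sum_power2_eq_zero_iff)
      then have "s\<^sup>2 / c / (1 + (r t * r' t / c)\<^sup>2) = c / (r t)\<^sup>2"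
      proof -
        have "1 + (r t * r' t / c)\<^sup>2 = ((r t)\<^sup>2 * s\<^sup>2) / c\<^sup>2"
          using c by (simp flip: sum add: power_divide add_divide_distrib)
        then show ?thesis
          using \<open>s\<^sup>2 \<noteq> 0\<close> c pos[OF that] by (simp add: field_simps power2_eq_square)
      qed
      moreover have "(\<theta> has_real_derivative
          s\<^sup>2 / c / (1 + ((s\<^sup>2 * t + r 0 * r' 0) / c)\<^sup>2)) (at t within ?I)"
        unfolding \<theta>_def using c
        by (auto intro!: derivative_eq_intros simp: field_simps)
      ultimately show ?thesis
        by (simp add: rr'[OF that])
    qed
    \<comment> \<open>\<open>(f, b)\<close> is the initial pair
      \<open>(r 0 * \<alpha>, b\<^sub>0)\<close> rotated by \<open>\<theta>\<close>, so f' = -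
      \<theta>' b and b' = \<theta>' f. The component of A along \<open>n\<close> stays fixed
      because v is parallel to \<open>e\<close>.\<close>
    define f where "f = (\<lambda>t. r 0 * \<alpha> * cos (\<theta> t) - b\<^sub>0 * sin (\<theta> t))"
    define b where "b = (\<lambda>t. r 0 * \<alpha> * sin (\<theta> t) + b\<^sub>0 * cos (\<theta> t))"
    define A where "A = (\<lambda>t. r 0 *\<^sub>R n + f t *\<^sub>R e)"
    have f': "(f has_real_derivative - (b t * (c / (r t)\<^sup>2))) (at t within ?I)"
      and b': "(b has_real_derivative f t * (c / (r t)\<^sup>2)) (at t within ?I)" if "t \<in> ?I" for t
      unfolding f_def b_def
      by (rule derivative_eq_intros \<theta>'[OF that] refl | simp add: algebra_simps)+
    have A': "(A has_vector_derivative - (b t *\<^sub>R v t)) (at t within ?I)" if "t \<in> ?I" for t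
      using has_vector_derivative_add[OF has_vector_derivative_const
          has_vector_derivative_scaleR[OF f'[OF that] has_vector_derivative_const[of e]]]
      by (simp add: A_def v[OF that])
    have "(b has_vector_derivative v t \<bullet> A t) (at t within ?I)" if "t \<in> ?I" for t
      using b'[OF that] by (simp add: A_def v[OF that] inner_add_right ne ee mult.commute
          has_real_derivative_iff_has_vector_derivative)
    \<comment> \<open>Here \<open>\<theta> 0 = 0\<close>, and
      \<open>n + \<alpha> *\<^sub>R e\<close> recovers \<open>a\<^sub>0\<close>.\<close>
    moreover have "A 0 = r 0 *\<^sub>R a\<^sub>0" "b 0 = b\<^sub>0"
      by (simp_all add: A_def f_def b_def n_def \<theta>_def algebra_simps)
    ultimately have "cone_parallel_transport (\<lambda>t. (p t, r t)) (a\<^sub>0, b\<^sub>0) u \<longleftrightarrow>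
        (\<forall>t\<in>?I. u t = ((1 / r t) *\<^sub>R A t, b t))"
      using A' by (intro cone_parallel_transport_iff[OF p r pos])
    then show ?thesis
      by (simp add: A_def f_def b_def scaleR_add_right)
  qed
  show ?thesis
    unfolding Let_def e_def[symmetric] \<alpha>_def[symmetric] n_def[symmetric]
    using q q0 zero nonzero[unfolded \<theta>_def] by blast
qed

end
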